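(* For every integer $t\ge1$ (and every integer $m\ge1$), $$v_m(S_1^t)\le\Big(1+\frac1t\Big)v_m^\star .$$
   Context: Notation: $[k]=\{1,\dots,k\}$. For $i\in[k]$, $\mathbb{P}_i=\sum_{j\in[|\Xi_i|]}\hat p_{ij}\delta_{\hat{\bm{x}}_{ij}}$ is a probability measure supported on a nonempty finite set $\Xi_i=\{\hat{\bm{x}}_{ij}\}_j\subseteq\mathbb{R}^d$ with $|\Xi_i|\le n$. Weights satisfy $\lambda_i\ge0$ and $\sum_{i\in[k]}\lambda_i=1$. $\mathcal{P}(\mathbb{R}^d)$ is the set of Borel probability measures on $\mathbb{R}^d$ with finite second moment and $W_2$ is the type-2 Wasserstein distance for the Euclidean norm. The support-size-constrained barycenter value is $$v_m^\star:=\inf\Big\{\sum_{i\in[k]}\lambda_iW_2^2(\mathbb{P},\mathbb{P}_i):\ \mathbb{P}\in\mathcal{P}(\mathbb{R}^d),\ |\mathrm{supp}(\mathbb{P})|\le m\Big\},$$ and for a finite set $G\subseteq\mathbb{R}^d$, $$v_m(G):=\inf\Big\{\sum_{i\in[k]}\lambda_iW_2^2(\mathbb{P},\mathbb{P}_i):\ \mathbb{P}\in\mathcal{P}(\mathbb{R}^d),\ \mathrm{supp}(\mathbb{P})\subseteq G,\ |\mathrm{supp}(\mathbb{P})|\le m\Big\}.$$ The candidate support is $S_1^t:=\{\frac1t\sum_{r\in[t]}\bm{y}_r:\ T_r\in[k],\ \bm{y}_r\in\Xi_{T_r},\ r\in[t]\}$, i.e. all averages of $t$ (not necessarily distinct)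 points of $\bigcup_{i\in[k]}\Xi_i$. *)

theory Defs
  imports "HOL-Probability.Probability"
begin

definition P2 :: "'a::euclidean_space measure set" where
  "P2 = {M. prob_space M \<and> sets M = sets borel \<and> integrable M (\<lambda>x. (norm x)\<^sup>2)}"

definition couplings ::
  "'a::euclidean_space measure \<Rightarrow> 'a measure \<Rightarrow> ('a \<times> 'a) measure set" where
  "couplings M N = {Q. prob_space Q \<and> sets Q = sets borel \<and>
     distr Q borel fst = M \<and> distr Q borel snd = N}"

(* On P2 the infimum is finite, since the product measure is a coupling of finite cost,
   so enn2real loses nothing there. *)
definition W2 :: "'a::euclidean_space measure \<Rightarrow> 'a measure \<Rightarrow> real" where
  "W2 M N = sqrt (enn2real (INF Q \<in> couplings M N. \<integral>\<^sup>+ z. ennreal ((dist (fst z) (snd z))\<^sup>2) \<partial>Q))"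

definition supp :: "'a::topological_space measure \<Rightarrow> 'a set" where
  "supp M = {x. \<forall>U. open U \<and> x \<in> U \<longrightarrow> emeasure M U > 0}"

definition discrete_measure :: "'a::topological_space set \<Rightarrow> ('a \<Rightarrow> real) \<Rightarrow> 'a measure" where
  "discrete_measure X p =
     measure_of UNIV (sets borel) (\<lambda>A. \<Sum>x\<in>X. ennreal (p x) * emeasure (return borel x) A)"

(* measure_of yields the null measure unless its last argument is a measure on the given
   sigma-algebra; for a finite weighted sum of Diracs it always is. *)
lemma emeasure_discrete_measure:
  assumes "A \<in> sets borel"
  shows "emeasure (discrete_measure X p) A =
    (\<Sum>x\<in>X. ennreal (p x) * emeasure (return borel x) A)"
  unfolding discrete_measure_def
proof (rule emeasure_measure_of_sigma)
  show "sigma_algebra (UNIV :: 'a set) (sets borel)"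
    using sets.sigma_algebra_axioms[of "borel :: 'a measure"] by simp
  show "positive (sets borel) (\<lambda>A. \<Sum>x\<in>X. ennreal (p x) * emeasure (return borel x) A)"
    by (simp add: positive_def)
  show "countably_additive (sets borel) (\<lambda>A. \<Sum>x\<in>X. ennreal (p x) * emeasure (return borel x) A)"
  proof (rule countably_additiveI)
    fix F :: "nat \<Rightarrow> 'a set"
    assume F: "range F \<subseteq> sets borel" "disjoint_family F"
    have "(\<Sum>i. \<Sum>x\<in>X. ennreal (p x) * emeasure (return borel x) (F i)) =
      (\<Sum>x\<in>X. \<Sum>i. ennreal (p x) * emeasure (return borel x) (F i))"
      by (rule suminf_sum) simp
    also have "\<dots> = (\<Sum>x\<in>X. ennreal (p x) * emeasure (return borel x) (\<Union>i. F i))"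
      using F by (simp only: ennreal_suminf_cmult suminf_emeasure sets_return)
    finally show "(\<Sum>i. \<Sum>x\<in>X. ennreal (p x) * emeasure (return borel x) (F i)) =
      (\<Sum>x\<in>X. ennreal (p x) * emeasure (return borel x) (\<Union>i. F i))" .
  qed
qed (use assms in auto)

definition bary_cost ::
  "nat \<Rightarrow> (nat \<Rightarrow> real) \<Rightarrow> (nat \<Rightarrow> 'a::euclidean_space measure) \<Rightarrow> 'a measure \<Rightarrow> real" where
  "bary_cost k l P Q = (\<Sum>i\<in>{1..k}. l i * (W2 Q (P i))\<^sup>2)"

definition v_star ::
  "nat \<Rightarrow> nat \<Rightarrow> (nat \<Rightarrow> real) \<Rightarrow> (nat \<Rightarrow> 'a::euclidean_space measure) \<Rightarrow> real" where
  "v_star m k l P = Inf {bary_cost k l P Q | Q. Q \<in> P2 \<and> finite (supp Q) \<and> card (supp Q) \<le> m}"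

definition v_on ::
  "nat \<Rightarrow> nat \<Rightarrow> (nat \<Rightarrow> real) \<Rightarrow> (nat \<Rightarrow> 'a::euclidean_space measure) \<Rightarrow> 'a set \<Rightarrow> real" where
  "v_on m k l P G =
     Inf {bary_cost k l P Q | Q. Q \<in> P2 \<and> supp Q \<subseteq> G \<and> finite (supp Q) \<and> card (supp Q) \<le> m}"

definition S1 :: "nat \<Rightarrow> nat \<Rightarrow> (nat \<Rightarrow> 'a::real_vector set) \<Rightarrow> 'a set" where
  "S1 t k X = {(1 / real t) *\<^sub>R (\<Sum>r\<in>{1..t}. y r) | T y.
     \<forall>r\<in>{1..t}. T r \<in> {1..k} \<and> y r \<in> X (T r)}"

end

theory Submission
  imports Defs
begin

text \<open>Fix a measure supported on a finite set \<open>Z\<close> and couplings \<open>\<pi>\<^sub>i\<close> with the given measures.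
  Every \<open>z \<in> Z\<close> sends mass \<open>l i * \<pi>\<^sub>i(z, x)\<close> to \<open>x\<close>. A mean of \<open>t\<close> independent samples from the
  normalised mass is, in expectation, a centre whose cost is at most \<open>1 + 1/t\<close> times that of the
  barycentre, hence of \<open>z\<close>. Moving each \<open>z\<close> to a good mean yields a measure on at most as many
  points, all averages of \<open>t\<close> data points, and pushing the couplings forward bounds its cost.\<close>

section \<open>Weighted means and sampling in an inner product space\<close>

lemma exists_le_weighted_average:
  fixes g w :: "'i \<Rightarrow> real"
  assumes "finite A" and w: "\<And>a. a \<in> A \<Longrightarrow> w a \<ge> 0" and pos: "sum w A > 0"
    and le: "(\<Sum>a\<in>A. w a * g a) \<le> sum w A * B"
  shows "\<exists>a\<in>A. g a \<le> B"
proof (rule ccontr)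
  assume "\<not> ?thesis"
  then have gt: "\<And>a. a \<in> A \<Longrightarrow> g a > B" by force
  \<comment> \<open>An index of positive weight makes the comparison of the two sums strict.\<close>
  obtain b where b: "b \<in> A" "w b > 0"
    using pos w by (metis less_le sum.neutral order_less_irrefl)
  have "(\<Sum>a\<in>A. w a * B) < (\<Sum>a\<in>A. w a * g a)"
    using assms(1) b gt w
    by (intro sum_strict_mono_ex1) (auto intro: mult_left_mono less_imp_le intro!: bexI[of _ b])
  then show False using le by (simp add: sum_distrib_right)
qed

text \<open>Splitting \<open>s - v a\<close> at \<open>c\<close> leaves a cross term linear in
  \<open>v a - c\<close>, whose weighted sum vanishes by hypothesis. This is the parallel axis
  identity; for positive total weight \<open>c\<close> is the weighted centroid.\<close>

lemma weighted_sum_dist_square: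
  fixes v :: "'i \<Rightarrow> 'a::real_inner"
  assumes c: "(\<Sum>a\<in>A. w a *\<^sub>R (v a - c)) = 0"
  shows "(\<Sum>a\<in>A. w a * (norm (s - v a))\<^sup>2) =
    sum w A * (norm (s - c))\<^sup>2 + (\<Sum>a\<in>A. w a * (norm (v a - c))\<^sup>2)"
proof -
  have "(norm (s - v a))\<^sup>2 = (norm (s - c))\<^sup>2 + (norm (v a - c))\<^sup>2 - 2 * ((s - c) \<bullet> (v a - c))" for a
    unfolding power2_norm_eq_inner by (simp add: inner_simps inner_commute)
  then have "(\<Sum>a\<in>A. w a * (norm (s - v a))\<^sup>2) =
    (\<Sum>a\<in>A. w a * (norm (s - c))\<^sup>2 + w a * (norm (v a - c))\<^sup>2
      - 2 * ((s - c) \<bullet> (w a *\<^sub>R (v a - c))))"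
    by (simp add: right_diff_distrib distrib_left mult.left_commute)
  also have "\<dots> = sum w A * (norm (s - c))\<^sup>2 + (\<Sum>a\<in>A. w a * (norm (v a - c))\<^sup>2)
      - 2 * ((s - c) \<bullet> (\<Sum>a\<in>A. w a *\<^sub>R (v a - c)))"
    by (simp add: sum.distrib sum_subtractf sum_distrib_right sum_distrib_left inner_sum_right)
  finally show ?thesis using c by simp
qed

text \<open>Derandomised sampling: the next sample is chosen by averaging, so no product measure on
  \<open>t\<close>-tuples is needed.\<close>

lemma exists_sample_sum:
  fixes v :: "'i \<Rightarrow> 'a::real_inner"
  assumes "finite A" and w: "\<And>a. a \<in> A \<Longrightarrow> w a \<ge> 0" and pos: "sum w A > 0"
    and c: "(\<Sum>a\<in>A. w a *\<^sub>R (v a - c)) = 0"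
  shows "\<exists>y. (\<forall>r. y r \<in> A) \<and>
    (norm (\<Sum>r\<in>{1..t}. v (y r) - c))\<^sup>2 \<le> real t * ((\<Sum>a\<in>A. w a * (norm (v a - c))\<^sup>2) / sum w A)"
proof (induction t)
  case 0
  \<comment> \<open>\<open>y\<close> is a total function, so even zero samples require an element of
    \<open>A\<close>; positive total weight provides one.\<close>
  obtain a where "a \<in> A" using pos by fastforce
  then show ?case by (intro exI[of _ "\<lambda>_. a"]) auto
next
  case (Suc t)
  define V where "V = (\<Sum>a\<in>A. w a * (norm (v a - c))\<^sup>2) / sum w A"
  obtain y where y: "\<And>r. y r \<in> A" "(norm (\<Sum>r\<in>{1..t}. v (y r) - c))\<^sup>2 \<le> real t * V"
    using Suc.IH unfolding V_def by blast
  define S where "S = (\<Sum>r\<in>{1..t}. v (y r) - c)"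
  \<comment> \<open>The length of the next partial sum is the distance from \<open>c - S\<close> to
    the new sample. By the parallel axis identity the weighted mean of its square is
    \<open>(norm S)\<^sup>2 + V\<close>, so some sample adds at most the variance
    \<open>V\<close>.\<close>
  have "(\<Sum>a\<in>A. w a * (norm (S + (v a - c)))\<^sup>2) = (\<Sum>a\<in>A. w a * (norm ((c - S) - v a))\<^sup>2)"
  proof (rule sum.cong)
    fix a
    have "c - S - v a = - (S + (v a - c))" by simp
    then show "w a * (norm (S + (v a - c)))\<^sup>2 = w a * (norm (c - S - v a))\<^sup>2"
      by (simp only: norm_minus_cancel)
  qed simp
  also have "\<dots> = sum w A * ((norm S)\<^sup>2 + V)"
    using pos by (subst weighted_sum_dist_square[OF c]) (simp add: V_def field_simps)
  finally have "\<exists>b\<in>A. (norm (S + (v b - c)))\<^sup>2 \<le> (norm S)\<^sup>2 + V"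
    by (intro exists_le_weighted_average[OF assms(1) w pos]) simp_all
  then obtain b where b: "b \<in> A" "(norm (S + (v b - c)))\<^sup>2 \<le> (norm S)\<^sup>2 + V" ..
  have "(\<Sum>r\<in>{1..Suc t}. v ((y(Suc t := b)) r) - c) = S + (v b - c)"
    by (simp add: S_def)
  then show ?case
    using b y by (intro exI[of _ "y(Suc t := b)"]) (auto simp: V_def[symmetric] S_def algebra_simps)
qed

text \<open>Some mean of \<open>t\<close> samples has squared distance at most variance over
  \<open>t\<close> from the centroid. By the parallel axis identity this costs at most a factor
  \<open>1 + 1/t\<close> over the centroid, which is itself no worse than any
  \<open>z\<close>.\<close>

lemma exists_sample_mean:
  fixes v :: "'i \<Rightarrow> 'a::real_inner"
  assumes "finite A" "A \<noteq> {}" and w: "\<And>a. a \<in> A \<Longrightarrow> w a \<ge> 0" and t: "t \<ge> 1"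
  shows "\<exists>y. (\<forall>r. y r \<in> A) \<and>
    (\<Sum>a\<in>A. w a * (norm ((1 / real t) *\<^sub>R (\<Sum>r\<in>{1..t}. v (y r)) - v a))\<^sup>2)
      \<le> (1 + 1 / real t) * (\<Sum>a\<in>A. w a * (norm (z - v a))\<^sup>2)"
proof (cases "sum w A > 0")
  case False
  \<comment> \<open>With total weight zero both sides are 0, so any choice from \<open>A\<close>
    works.\<close>
  then have "\<And>a. a \<in> A \<Longrightarrow> w a = 0"
    using w assms(1) by (metis sum_nonneg sum_nonneg_eq_0_iff less_le)
  then show ?thesis using assms(2) by (auto intro: exI[of _ "\<lambda>_. SOME a. a \<in> A"] some_in_eq[THEN iffD2])
next
  case True
  define c where "c = (1 / sum w A) *\<^sub>R (\<Sum>a\<in>A. w a *\<^sub>R v a)"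
  have c: "(\<Sum>a\<in>A. w a *\<^sub>R (v a - c)) = 0"
    unfolding scaleR_diff_right sum_subtractf scaleR_sum_left[symmetric]
    using True by (simp add: c_def)
  define D where "D = (\<Sum>a\<in>A. w a * (norm (v a - c))\<^sup>2)"
  obtain y where y: "\<And>r. y r \<in> A"
    "(norm (\<Sum>r\<in>{1..t}. v (y r) - c))\<^sup>2 \<le> real t * (D / sum w A)"
    using exists_sample_sum[OF assms(1) w True c] unfolding D_def by blast
  define s where "s = (1 / real t) *\<^sub>R (\<Sum>r\<in>{1..t}. v (y r))"
  have "s - c = (1 / real t) *\<^sub>R (\<Sum>r\<in>{1..t}. v (y r) - c)"
    using t by (simp add: s_def sum_subtractf scaleR_diff_right sum_constant_scaleR)
  then have "(norm (s - c))\<^sup>2 = (norm (\<Sum>r\<in>{1..t}. v (y r) - c))\<^sup>2 / (real t)\<^sup>2"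
    by (simp add: power_divide)
  \<comment> \<open>The bound on the sum grows like \<open>t\<close>, while averaging divides by the
    square of \<open>t\<close>: this is the source of \<open>1/t\<close>.\<close>
  also have "\<dots> \<le> real t * (D / sum w A) / (real t)\<^sup>2"
    by (intro divide_right_mono y) simp
  finally have "sum w A * (norm (s - c))\<^sup>2 \<le> D / real t"
    using True t by (simp add: field_simps power2_eq_square)
  then have "(\<Sum>a\<in>A. w a * (norm (s - v a))\<^sup>2) \<le> (1 + 1 / real t) * D"
    unfolding weighted_sum_dist_square[OF c] by (simp add: D_def algebra_simps)
  also have "\<dots> \<le> (1 + 1 / real t) * (\<Sum>a\<in>A. w a * (norm (z - v a))\<^sup>2)"
    unfolding weighted_sum_dist_square[OF c, of z]
    using True by (intro mult_left_mono) (auto simp: D_def)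
  finally show ?thesis using y unfolding s_def by blast
qed

section \<open>Measures carried by finite sets\<close>

text \<open>Every point outside the support has a null basic neighbourhood, and countably many of
  these cover the complement.\<close>

lemma AE_in_supp:
  fixes M :: "'a::second_countable_topology measure"
  assumes M: "sets M = sets borel"
  shows "AE x in M. x \<in> supp M"
proof -
  obtain B :: "'a set set" where B: "countable B" "topological_basis B"
    using ex_countable_basis by blast
  define N where "N = {b \<in> B. emeasure M b = 0}"
  have "(\<Union>b\<in>N. b) \<in> null_sets M"
    using B by (intro null_sets_UN') (auto simp: N_def null_sets_def M topological_basis_open)
  moreover have "x \<in> (\<Union>b\<in>N. b)" if x: "x \<notin> supp M" for x
  proof -
    obtain U where U: "open U" "x \<in> U" "emeasure M U = 0"
      using x unfolding supp_def zero_less_iff_neq_zero by blast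
    obtain b where b: "b \<in> B" "x \<in> b" "b \<subseteq> U"
      using topological_basisE[OF B(2) U(1,2)] by blast
    have "emeasure M b \<le> emeasure M U"
      using b U by (intro emeasure_mono) (auto simp: M)
    then show ?thesis using b U by (auto simp: N_def)
  qed
  ultimately show ?thesis by (intro AE_I'[of "\<Union>b\<in>N. b"]) auto
qed

text \<open>Finite sets are closed in a T1 space, so the complement of \<open>F\<close> is an open
  null set and contains no point of the support.\<close>

lemma supp_subset_finite:
  fixes M :: "'a::t1_space measure"
  assumes M: "sets M = sets borel" and F: "finite F" and ae: "AE x in M. x \<in> F"
  shows "supp M \<subseteq> F"
proof
  fix x assume x: "x \<in> supp M"
  have "open (- F)" using F by (simp add: finite_imp_closed open_Compl)
  moreover have "emeasure M (- F) = 0"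
    using ae \<open>open (- F)\<close> by (subst AE_iff_measurable[symmetric, of _ _ "\<lambda>x. x \<in> F"])
      (auto simp: M sets_eq_imp_space_eq[OF M])
  ultimately show "x \<in> F" using x by (force simp: supp_def)
qed

lemma finite_support_in_P2:
  fixes M :: "'a::euclidean_space measure"
  assumes "prob_space M" and M: "sets M = sets borel" and F: "finite F" and ae: "AE x in M. x \<in> F"
  shows "M \<in> P2"
proof -
  interpret prob_space M by fact
  have "AE x in M. norm ((norm x)\<^sup>2) \<le> (\<Sum>y\<in>F. (norm y)\<^sup>2)"
    using ae by eventually_elim (auto intro!: member_le_sum F)
  then have "integrable M (\<lambda>x. (norm x)\<^sup>2)"
    by (rule integrable_const_bound) (simp add: measurable_cong_sets[OF M refl])
  then show ?thesis using assms by (simp add: P2_def)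
qed

lemma nn_integral_AE_finite:
  fixes M :: "'a::t1_space measure"
  assumes M: "sets M = sets borel" and F: "finite F" and ae: "AE x in M. x \<in> F"
  shows "(\<integral>\<^sup>+x. g x \<partial>M) = (\<Sum>x\<in>F. g x * emeasure M {x})"
proof -
  have "(\<integral>\<^sup>+x. g x \<partial>M) = (\<integral>\<^sup>+x. g x * indicator F x \<partial>M)"
    by (rule nn_integral_cong_AE) (use ae in eventually_elim, simp)
  also have "\<dots> = (\<Sum>x\<in>F. g x * emeasure M {x})"
    by (rule nn_integral_indicator_finite) (use F in \<open>auto simp: M\<close>)
  finally show ?thesis .
qed

lemma sets_discrete_measure [simp]:
  fixes X :: "'a::topological_space set"
  shows "sets (discrete_measure X p) = sets borel"
  using sigma_algebra.sets_measure_of_eq[OF sets.sigma_algebra_axioms[of "borel :: 'a measure"]]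
  by (simp add: discrete_measure_def)

lemma AE_discrete_measure:
  fixes X :: "'a::t1_space set"
  assumes "finite X"
  shows "AE x in discrete_measure X p. x \<in> X"
proof (rule AE_I')
  have b: "UNIV - X \<in> sets borel"
    using assms by (metis finite_imp_closed Compl_eq_Diff_UNIV borel_closed borel_comp)
  have "emeasure (discrete_measure X p) (UNIV - X) = 0"
    unfolding emeasure_discrete_measure[OF b] using b by (auto simp: emeasure_return)
  then show "UNIV - X \<in> null_sets (discrete_measure X p)" using b by auto
qed auto

lemma prob_space_discrete_measure:
  fixes X :: "'a::topological_space set"
  assumes "\<And>x. x \<in> X \<Longrightarrow> p x \<ge> 0" "sum p X = 1"
  shows "prob_space (discrete_measure X p)"
proof (rule prob_spaceI)
  have "space (discrete_measure X p) = UNIV"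
    using sets_eq_imp_space_eq[OF sets_discrete_measure] by simp
  moreover have "emeasure (discrete_measure X p) UNIV = (\<Sum>x\<in>X. ennreal (p x))"
    by (simp add: emeasure_discrete_measure emeasure_return)
  ultimately show "emeasure (discrete_measure X p) (space (discrete_measure X p)) = 1"
    using assms by (simp add: sum_ennreal)
qed

section \<open>Couplings and their transport costs\<close>

lemma coupling_AE_Times:
  fixes M N :: "'a::euclidean_space measure"
  assumes "Q \<in> couplings M N" and ae: "AE x in M. x \<in> F" "AE x in N. x \<in> G"
  shows "AE z in Q. z \<in> F \<times> G"
proof -
  have Q: "sets Q = sets borel" "distr Q borel fst = M" "distr Q borel snd = N"
    using assms(1) by (auto simp: couplings_def)
  have [measurable]: "fst \<in> Q \<rightarrow>\<^sub>M borel" "snd \<in> Q \<rightarrow>\<^sub>M borel"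
    unfolding measurable_cong_sets[OF Q(1) refl] borel_prod[symmetric] by simp_all
  have "AE z in Q. fst z \<in> F" "AE z in Q. snd z \<in> G"
    using ae unfolding Q(2,3)[symmetric] by (auto dest!: AE_distrD[rotated])
  then show ?thesis by eventually_elim (auto simp: mem_Times_iff)
qed

text \<open>Provides the coupling that later shows the infimum inside \<open>W2\<close> to be finite
  for marginals carried by finite sets.\<close>

lemma pair_measure_in_couplings:
  fixes M N :: "'a::euclidean_space measure"
  assumes "prob_space M" "prob_space N" "sets M = sets borel" "sets N = sets borel"
  shows "M \<Otimes>\<^sub>M N \<in> couplings M N"
proof -
  interpret M: prob_space M by fact
  interpret N: prob_space N by fact
  interpret pair_prob_space M N ..
  have "distr (M \<Otimes>\<^sub>M N) borel snd = N"
  proof (rule measure_eqI)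
    fix A assume A: "A \<in> sets (distr (M \<Otimes>\<^sub>M N) borel snd)"
    have "snd -` A \<inter> space (M \<Otimes>\<^sub>M N) = space M \<times> A"
      using A assms sets.sets_into_space[of A N] by (auto simp: space_pair_measure)
    then show "emeasure (distr (M \<Otimes>\<^sub>M N) borel snd) A = emeasure N A"
      using A assms(4) measurable_snd[of M N]
      by (subst emeasure_distr)
        (auto simp: M.emeasure_space_1 N.emeasure_pair_measure_Times measurable_cong_sets[OF refl assms(4)])
  qed (simp add: assms)
  moreover have "distr (M \<Otimes>\<^sub>M N) borel fst = M"
  proof (rule measure_eqI)
    fix A assume A: "A \<in> sets (distr (M \<Otimes>\<^sub>M N) borel fst)"
    have "fst -` A \<inter> space (M \<Otimes>\<^sub>M N) = A \<times> space N"
      using A assms sets.sets_into_space[of A M] by (auto simp: space_pair_measure)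
    then show "emeasure (distr (M \<Otimes>\<^sub>M N) borel fst) A = emeasure M A"
      using A assms(3) measurable_fst[of M N]
      by (subst emeasure_distr)
        (auto simp: N.emeasure_space_1 N.emeasure_pair_measure_Times measurable_cong_sets[OF refl assms(3)])
  qed (simp add: assms)
  moreover have "sets (M \<Otimes>\<^sub>M N) = sets borel"
    using sets_pair_measure_cong[OF assms(3,4)] by (simp only: borel_prod)
  ultimately show ?thesis by (simp add: couplings_def prob_space_axioms)
qed

lemma coupling_distr_fst:
  fixes M N :: "'a::euclidean_space measure"
  assumes "Q \<in> couplings M N" and f: "f \<in> borel_measurable borel"
  shows "distr Q borel (map_prod f id) \<in> couplings (distr M borel f) N"
proof -
  have Q: "prob_space Q" "sets Q = sets borel" "distr Q borel fst = M" "distr Q borel snd = N"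
    using assms(1) by (auto simp: couplings_def)
  have fst [measurable]: "fst \<in> Q \<rightarrow>\<^sub>M borel" and snd [measurable]: "snd \<in> Q \<rightarrow>\<^sub>M borel"
    unfolding measurable_cong_sets[OF Q(2) refl] borel_prod[symmetric] by simp_all
  have [measurable]: "map_prod f id \<in> Q \<rightarrow>\<^sub>M borel"
    using measurable_Pair[OF measurable_compose[OF fst f] snd]
    by (simp add: borel_prod map_prod_def case_prod_beta')
  have b: "fst \<in> (borel :: ('a \<times> 'a) measure) \<rightarrow>\<^sub>M borel" "snd \<in> (borel :: ('a \<times> 'a) measure) \<rightarrow>\<^sub>M borel"
    unfolding borel_prod[symmetric] by simp_all
  have "distr (distr Q borel (map_prod f id)) borel fst = distr (distr Q borel fst) borel f"
    using f b by (subst (1 2) distr_distr) (auto intro!: distr_cong)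
  moreover have "distr (distr Q borel (map_prod f id)) borel snd = distr Q borel snd"
    using b by (subst distr_distr) (auto intro!: distr_cong)
  ultimately show ?thesis
    using Q by (auto simp: couplings_def intro!: prob_space.prob_space_distr)
qed

text \<open>For a coupling \<open>Q\<close> carried by \<open>Z \<times> Y\<close>, the cost of \<open>Q\<close> after its first marginal is
  pushed forward along \<open>f\<close>.\<close>

definition tcost :: "('a::euclidean_space \<times> 'a) measure \<Rightarrow> 'a set \<Rightarrow> 'a set \<Rightarrow> ('a \<Rightarrow> 'a) \<Rightarrow> real" where
  "tcost Q Z Y f = (\<Sum>z\<in>Z. \<Sum>x\<in>Y. measure Q {(z, x)} * (norm (f z - x))\<^sup>2)"

lemma tcost_nonneg: "tcost Q Z Y f \<ge> 0"
  by (auto simp: tcost_def intro!: sum_nonneg)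

text \<open>\<open>Q\<close> is concentrated on the finite set \<open>Z \<times> Y\<close>, so the
  integral is a sum over atoms. The identity as \<open>f\<close> gives the cost of \<open>Q\<close>
  itself.\<close>

lemma nn_integral_tcost:
  fixes M N :: "'a::euclidean_space measure"
  assumes Q: "Q \<in> couplings M N" and fin: "finite Z" "finite Y"
    and ae: "AE x in M. x \<in> Z" "AE x in N. x \<in> Y"
  shows "(\<integral>\<^sup>+ z. ennreal ((dist (f (fst z)) (snd z))\<^sup>2) \<partial>Q) = ennreal (tcost Q Z Y f)"
proof -
  have s: "sets Q = sets borel" and "prob_space Q" using Q by (auto simp: couplings_def)
  interpret prob_space Q by fact
  have "(\<integral>\<^sup>+ z. ennreal ((dist (f (fst z)) (snd z))\<^sup>2) \<partial>Q) =
    (\<Sum>z\<in>Z \<times> Y. ennreal ((dist (f (fst z)) (snd z))\<^sup>2) * emeasure Q {z})"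
    by (rule nn_integral_AE_finite[OF s _ coupling_AE_Times[OF Q ae]]) (simp add: fin)
  also have "\<dots> = (\<Sum>z\<in>Z \<times> Y. ennreal (measure Q {z} * (norm (f (fst z) - snd z))\<^sup>2))"
    by (simp add: emeasure_eq_measure ennreal_mult dist_norm mult.commute)
  also have "\<dots> = ennreal (\<Sum>z\<in>Z \<times> Y. measure Q {z} * (norm (f (fst z) - snd z))\<^sup>2)"
    by (rule sum_ennreal) auto
  finally show ?thesis by (simp add: tcost_def sum.cartesian_product case_prod_beta')
qed

text \<open>The push-forward of \<open>Q\<close> along \<open>map_prod f id\<close> competes in the
  infimum, and a change of variables computes its cost.\<close>

lemma W2_distr_le_tcost:
  fixes M N :: "'a::euclidean_space measure"
  assumes Q: "Q \<in> couplings M N" and fin: "finite Z" "finite Y"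
    and ae: "AE x in M. x \<in> Z" "AE x in N. x \<in> Y" and f: "f \<in> borel_measurable borel"
  shows "(W2 (distr M borel f) N)\<^sup>2 \<le> tcost Q Z Y f"
proof -
  have s: "sets Q = sets borel" using Q by (auto simp: couplings_def)
  have fst: "fst \<in> Q \<rightarrow>\<^sub>M borel" and snd: "snd \<in> Q \<rightarrow>\<^sub>M borel"
    unfolding measurable_cong_sets[OF s refl] borel_prod[symmetric] by simp_all
  have m: "map_prod f id \<in> Q \<rightarrow>\<^sub>M borel"
    using measurable_Pair[OF measurable_compose[OF fst f] snd]
    by (simp add: borel_prod map_prod_def case_prod_beta')
  have "(INF Q \<in> couplings (distr M borel f) N. \<integral>\<^sup>+ z. ennreal ((dist (fst z) (snd z))\<^sup>2) \<partial>Q)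
    \<le> (\<integral>\<^sup>+ z. ennreal ((dist (fst z) (snd z))\<^sup>2) \<partial>distr Q borel (map_prod f id))"
    by (rule INF_lower[OF coupling_distr_fst[OF Q f]])
  also have "\<dots> = (\<integral>\<^sup>+ z. ennreal ((dist (f (fst z)) (snd z))\<^sup>2) \<partial>Q)"
    using m by (subst nn_integral_distr) (auto simp: borel_prod[symmetric])
  also have "\<dots> = ennreal (tcost Q Z Y f)" by (rule nn_integral_tcost[OF Q fin ae])
  finally show ?thesis
    using enn2real_mono[of _ "ennreal (tcost Q Z Y f)"] by (simp add: W2_def tcost_nonneg)
qed

text \<open>A slack \<open>e\<close> stands in for the existence of an optimal coupling.\<close>

lemma exists_near_optimal_coupling:
  fixes M N :: "'a::euclidean_space measure"
  assumes "prob_space M" "prob_space N" "sets M = sets borel" "sets N = sets borel"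
    and fin: "finite Z" "finite Y" and ae: "AE x in M. x \<in> Z" "AE x in N. x \<in> Y" and e: "e > 0"
  shows "\<exists>Q \<in> couplings M N. tcost Q Z Y (\<lambda>z. z) \<le> (W2 M N)\<^sup>2 + e"
proof -
  define I where "I = (INF Q \<in> couplings M N. \<integral>\<^sup>+ z. ennreal ((dist (fst z) (snd z))\<^sup>2) \<partial>Q)"
  note cost = nn_integral_tcost[OF _ fin ae, of _ "\<lambda>z. z"]
  \<comment> \<open>The product coupling has finite cost, so \<open>enn2real\<close> loses nothing
    at \<open>I\<close>.\<close>
  have "I \<le> ennreal (tcost (M \<Otimes>\<^sub>M N) Z Y (\<lambda>z. z))"
    unfolding I_def using pair_measure_in_couplings[OF assms(1-4)]
    by (subst cost[symmetric]) (auto intro: INF_lower)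
  then have I: "I = ennreal (enn2real I)"
    by (metis ennreal_enn2real ennreal_less_top order_le_less_trans)
  then have "I < ennreal (enn2real I + e)"
    using e by (metis enn2real_nonneg ennreal_lessI less_add_same_cancel1 add_nonneg_pos)
  then obtain Q where Q: "Q \<in> couplings M N"
      "(\<integral>\<^sup>+ z. ennreal ((dist (fst z) (snd z))\<^sup>2) \<partial>Q) < ennreal (enn2real I + e)"
    unfolding I_def by (subst (asm) INF_less_iff) blast
  then have "tcost Q Z Y (\<lambda>z. z) \<le> enn2real I + e"
    by (simp add: cost ennreal_less_iff tcost_nonneg)
  then show ?thesis using Q by (auto simp: W2_def I_def[symmetric])
qed

section \<open>Rounding to sample means and the final bound\<close>

text \<open>The total cost separates over \<open>z\<close>, so each \<open>z\<close> can be rounded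
  on its own, looking only at the mass leaving it. Hence one \<open>f\<close> serves every
  \<open>Z\<close>.\<close>

lemma exists_rounding_map:
  fixes X :: "nat \<Rightarrow> 'a::euclidean_space set" and Q :: "nat \<Rightarrow> ('a \<times> 'a) measure"
  assumes X: "\<And>i. i \<in> {1..k} \<Longrightarrow> finite (X i)" "\<And>i. i \<in> {1..k} \<Longrightarrow> X i \<noteq> {}" and k: "k \<ge> 1"
    and l: "\<And>i. i \<in> {1..k} \<Longrightarrow> l i \<ge> 0" and t: "t \<ge> 1"
  shows "\<exists>f. (\<forall>z. f z \<in> S1 t k X) \<and>
    (\<forall>Z. (\<Sum>i\<in>{1..k}. l i * tcost (Q i) Z (X i) f)
      \<le> (1 + 1 / real t) * (\<Sum>i\<in>{1..k}. l i * tcost (Q i) Z (X i) (\<lambda>z. z)))"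
proof -
  \<comment> \<open>Pairs keep apart equal data points of different \<open>X i\<close>.
    \<open>C z s\<close> is the cost of the mass leaving \<open>z\<close> when it starts from
    \<open>s\<close> instead.\<close>
  define A where "A = Sigma {1..k} X"
  define C where "C z s = (\<Sum>(i, x)\<in>A. l i * measure (Q i) {(z, x)} * (norm (s - x))\<^sup>2)" for z s
  have "1 \<in> {1..k}" using k by simp
  then have A: "finite A" "A \<noteq> {}" using X(2)[of 1] by (auto simp: A_def Sigma_empty_iff X(1))
  have "\<exists>s \<in> S1 t k X. C z s \<le> (1 + 1 / real t) * C z z" for z
  proof -
    obtain y where y: "\<forall>r. y r \<in> A"
      "C z ((1 / real t) *\<^sub>R (\<Sum>r\<in>{1..t}. snd (y r))) \<le> (1 + 1 / real t) * C z z"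
      using exists_sample_mean[OF A _ t, of "\<lambda>a. l (fst a) * measure (Q (fst a)) {(z, snd a)}" snd z] l
      by (auto simp: A_def C_def case_prod_beta')
    have "fst (y r) \<in> {1..k} \<and> snd (y r) \<in> X (fst (y r))" for r
      using spec[OF y(1), of r] by (cases "y r") (simp add: A_def)
    then have "(1 / real t) *\<^sub>R (\<Sum>r\<in>{1..t}. snd (y r)) \<in> S1 t k X"
      unfolding S1_def by (intro CollectI exI[of _ "\<lambda>r. fst (y r)"] exI[of _ "\<lambda>r. snd (y r)"]) simp
    then show ?thesis using y(2) by blast
  qed
  then obtain f where f: "\<And>z. f z \<in> S1 t k X" "\<And>z. C z (f z) \<le> (1 + 1 / real t) * C z z"
    by metis
  have cost: "(\<Sum>i\<in>{1..k}. l i * tcost (Q i) Z (X i) g) = (\<Sum>z\<in>Z. C z (g z))" for Z g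
  proof -
    have "C z s = (\<Sum>i\<in>{1..k}. \<Sum>x\<in>X i. l i * measure (Q i) {(z, x)} * (norm (s - x))\<^sup>2)" for z s
      unfolding C_def A_def using X by (subst sum.Sigma) auto
    then show ?thesis
      by (simp add: tcost_def sum_distrib_left mult.assoc) (rule sum.swap)
  qed
  show ?thesis
    unfolding cost sum_distrib_left using f by (intro exI[of _ f]) (auto intro!: sum_mono)
qed

theorem theorem6:
  fixes k n m t :: nat
    and X :: "nat \<Rightarrow> (real ^ 'd) set"
    and p :: "nat \<Rightarrow> real ^ 'd \<Rightarrow> real"
    and l :: "nat \<Rightarrow> real"
    and P :: "nat \<Rightarrow> (real ^ 'd) measure"
  assumes X: "\<And>i. i \<in> {1..k} \<Longrightarrow> finite (X i) \<and> X i \<noteq> {} \<and> card (X i) \<le> n"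
    and p_nonneg: "\<And>i x. i \<in> {1..k} \<Longrightarrow> x \<in> X i \<Longrightarrow> p i x \<ge> 0"
    and p_sum: "\<And>i. i \<in> {1..k} \<Longrightarrow> (\<Sum>x\<in>X i. p i x) = 1"
    and P: "\<And>i. i \<in> {1..k} \<Longrightarrow> P i = discrete_measure (X i) (p i)"
    and l_nonneg: "\<And>i. i \<in> {1..k} \<Longrightarrow> l i \<ge> 0"
    and l_sum: "(\<Sum>i\<in>{1..k}. l i) = 1"
    and t: "t \<ge> 1"
    and m: "m \<ge> 1"
  shows "v_on m k l P (S1 t k X) \<le> (1 + 1 / real t) * v_star m k l P"
proof -
  have fin: "finite (X i)" "X i \<noteq> {}" if "i \<in> {1..k}" for i using X that by auto
  have k: "k \<ge> 1" using l_sum by (cases k) auto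
  have PX: "prob_space (P i)" "sets (P i) = sets borel" "AE x in P i. x \<in> X i" if "i \<in> {1..k}" for i
    unfolding P[OF that] using that p_nonneg p_sum fin(1)
    by (auto simp del: atLeastAtMost_iff intro!: prob_space_discrete_measure AE_discrete_measure)
  have pos: "1 + 1 / real t > 0" by (simp add: add_pos_nonneg)
  have round: "v_on m k l P (S1 t k X) \<le> (1 + 1 / real t) * bary_cost k l P M"
    if M: "M \<in> P2" "finite (supp M)" "card (supp M) \<le> m" for M
  proof (rule field_le_epsilon)
    fix e :: real assume e: "e > 0"
    \<comment> \<open>The slack per coupling is chosen so that it becomes exactly \<open>e\<close>
      after multiplication by the approximation factor.\<close>
    define d where "d = e / (1 + 1 / real t)"
    have d: "d > 0" and de: "(1 + 1 / real t) * d = e"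
      using e pos by (simp_all add: d_def)
    define Z where "Z = supp M"
    have Z: "finite Z" "AE x in M. x \<in> Z" "card Z \<le> m" "prob_space M" "sets M = sets borel"
      using M AE_in_supp[of M] by (auto simp: Z_def P2_def)
    have "\<forall>i\<in>{1..k}. \<exists>Q \<in> couplings M (P i). tcost Q Z (X i) (\<lambda>z. z) \<le> (W2 M (P i))\<^sup>2 + d"
      using exists_near_optimal_coupling[OF Z(4) PX(1) Z(5) PX(2) Z(1) fin(1) Z(2) PX(3) d] by blast
    then obtain Q where Q: "\<And>i. i \<in> {1..k} \<Longrightarrow> Q i \<in> couplings M (P i)"
      "\<And>i. i \<in> {1..k} \<Longrightarrow> tcost (Q i) Z (X i) (\<lambda>z. z) \<le> (W2 M (P i))\<^sup>2 + d"
      by metis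
    obtain f where f: "\<And>z. f z \<in> S1 t k X"
      "(\<Sum>i\<in>{1..k}. l i * tcost (Q i) Z (X i) f)
        \<le> (1 + 1 / real t) * (\<Sum>i\<in>{1..k}. l i * tcost (Q i) Z (X i) (\<lambda>z. z))"
      using exists_rounding_map[where X = X and l = l and Q = Q, OF fin k l_nonneg t] by blast
    \<comment> \<open>\<open>f\<close> comes from a choice and need not be Borel. \<open>g\<close>
      agrees with it on \<open>Z\<close> and differs from a constant only on a finite set, hence is
      measurable.\<close>
    define g where "g z = (if z \<in> Z then f z else 0)" for z
    have g: "g \<in> borel_measurable borel"
      by (rule measurable_discrete_difference[where f = "\<lambda>_. 0" and X = Z])
        (use Z in \<open>auto simp: g_def intro: countable_finite\<close>)
    have gf: "tcost (Q i) Z (X i) g = tcost (Q i) Z (X i) f" for i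
      by (simp add: tcost_def g_def)
    define M' where "M' = distr M borel g"
    have gM: "g \<in> M \<rightarrow>\<^sub>M borel" using g measurable_cong_sets[OF Z(5) refl] by blast
    have M': "prob_space M'" "sets M' = sets borel"
      unfolding M'_def using gM Z by (auto intro: prob_space.prob_space_distr)
    have ae: "AE x in M'. x \<in> f ` Z"
      unfolding M'_def
    proof (subst AE_distr_iff[OF gM])
      show "AE z in M. g z \<in> f ` Z"
        using Z(2) by eventually_elim (simp add: g_def)
    qed (use Z(1) in \<open>simp add: finite_imp_closed\<close>)
    \<comment> \<open>Rounding may merge points but never creates new ones, so the bound
      \<open>m\<close> on the support size survives.\<close>
    have sup: "supp M' \<subseteq> f ` Z"
      using supp_subset_finite[OF M'(2) _ ae] Z by blast
    have "card (supp M') \<le> m"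
      using card_mono[OF _ sup] card_image_le[OF Z(1), of f] Z by force
    moreover have "finite (supp M')" using sup Z finite_subset by blast
    moreover have "supp M' \<subseteq> S1 t k X" using sup f by blast
    moreover have "M' \<in> P2" using finite_support_in_P2[OF M' _ ae] Z by blast
    ultimately have "v_on m k l P (S1 t k X) \<le> bary_cost k l P M'"
      unfolding v_on_def
      by (intro cInf_lower bdd_belowI[of _ 0])
        (auto simp: bary_cost_def intro!: sum_nonneg mult_nonneg_nonneg l_nonneg)
    also have "\<dots> \<le> (\<Sum>i\<in>{1..k}. l i * tcost (Q i) Z (X i) f)"
      unfolding bary_cost_def M'_def gf[symmetric]
      using W2_distr_le_tcost[OF Q(1) Z(1) fin(1) Z(2) PX(3) g]
      by (intro sum_mono mult_left_mono l_nonneg) auto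
    also have "\<dots> \<le> (1 + 1 / real t) * (\<Sum>i\<in>{1..k}. l i * tcost (Q i) Z (X i) (\<lambda>z. z))"
      by (rule f)
    also have "\<dots> \<le> (1 + 1 / real t) * (\<Sum>i\<in>{1..k}. l i * ((W2 M (P i))\<^sup>2 + d))"
      by (intro mult_left_mono sum_mono Q l_nonneg) auto
    \<comment> \<open>The weights sum to 1, so the slacks \<open>d\<close> average to
      \<open>d\<close>.\<close>
    also have "\<dots> = (1 + 1 / real t) * bary_cost k l P M + e"
      using l_sum by (simp add: bary_cost_def distrib_left sum.distrib sum_distrib_right[symmetric] de)
    finally show "v_on m k l P (S1 t k X) \<le> (1 + 1 / real t) * bary_cost k l P M + e" .
  qed
  \<comment> \<open>A Dirac measure has at most one support point, so \<open>m \<ge> 1\<close>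
    admits it; the set under the infimum in \<open>v_star\<close> is therefore nonempty, as
    \<open>cInf_greatest\<close> demands.\<close>
  define D :: "(real ^ 'd) measure" where "D = return borel 0"
  have D: "prob_space D" "sets D = sets borel" "AE x in D. x \<in> {0}"
    unfolding D_def by (simp_all add: prob_space_return AE_return)
  have "supp D \<subseteq> {0}" using supp_subset_finite[OF D(2) _ D(3)] by simp
  then have "finite (supp D)" "card (supp D) \<le> m"
    using m card_mono[of "{0}" "supp D"] by (auto intro: finite_subset)
  then have ne: "bary_cost k l P D \<in>
      {bary_cost k l P M | M. M \<in> P2 \<and> finite (supp M) \<and> card (supp M) \<le> m}"
    using finite_support_in_P2[OF D(1,2) _ D(3)] by auto
  \<comment> \<open>Dividing by the positive factor turns \<open>round\<close> into a lower bound
    for all admissible costs, which passes to their infimum.\<close>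
  have "v_on m k l P (S1 t k X) / (1 + 1 / real t) \<le> v_star m k l P"
    unfolding v_star_def using ne round pos
    by (intro cInf_greatest) (auto simp: pos_divide_le_eq mult.commute)
  then show ?thesis using pos by (simp add: pos_divide_le_eq mult.commute)
qed

end
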